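(* Let $\mathcal L$ be a finite distributive strong upper semilattice, let $\mathcal M$ be its set of meet-irreducible elements, let $\mathcal D=\mathcal D(\mathcal M)$ be the distributive lattice of order filters of $\mathcal M$ ordered by reverse inclusion, and define $\nu\colon\mathcal L\to\mathcal D$ by $\nu(x)=\{m\in\mathcal M : x\le m\}$. Then $\nu$ embeds $\mathcal L$ in $\mathcal D$ as an upwards-closed subalgebra; that is: (i) $\nu$ is order preserving and injective; (ii) $\nu(x\vee y)=\nu(x)\vee\nu(y)$ for all $x,y\in\mathcal L$; (iii) $\nu(x\wedge y)=\nu(x)\wedge\nu(y)$ for all $x,y\in\mathcal L$ having a common lower bound in $\mathcal L$; (iv) the image $\nu(\mathcal L)$ is an upwards-closed subset of $\mathcal D$.
   Context: A strong upper semilattice is an upper semilattice (a poset with binary joins $\vee$) with a greatest element $\mathbf 1$, in which any two elements having a common lower bound have a greatest lower bound, denoted $x\wedge y$. It is distributive if every interval $[a,b]$ is a distributive lattice. An element $m\in\mathcal L$ is meet-irreducible if whenever $m=p\wedge q$ (with $p\wedge q$ existing in $\mathcal L$) then $m=p$ or $m=q$; by this convention $\mathbf 1$ is meet-irreducible. $\mathcal M$ is the set of meet-irreducibles with the order induced from $\mathcal L$. $\mathcal D(\mathcal M)$ is the set of nonempty order filters (nonempty upward-closed subsets, hence containing $\mathbf 1$) of $\mathcal M$, ordered by reverse inclusion. So $\{\mathbf 1\}$ is the greatest element, $\mathcal M$ is the least element, the meet of $F,G$ is $F\cup G$ and the join is $F\cap G$. *)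

theory Defs
  imports "HOL-Algebra.Lattice"
begin

locale distributive_lattice = lattice +
  assumes meet_join_distrib:
    "\<lbrakk>x \<in> carrier L; y \<in> carrier L; z \<in> carrier L\<rbrakk>
      \<Longrightarrow> x \<sqinter> (y \<squnion> z) = (x \<sqinter> y) \<squnion> (x \<sqinter> z)"

locale strong_upper_semilattice = upper_semilattice + weak_partial_order_top +
  assumes inf_of_bounded_pair_exists:
    "\<lbrakk>x \<in> carrier L; y \<in> carrier L; Lower L {x, y} \<noteq> {}\<rbrakk>
      \<Longrightarrow> \<exists>i. greatest L i (Lower L {x, y})"

text \<open>Joins and meets in an interval are those of the interval as a poset in its own right.\<close>

locale distributive_strong_upper_semilattice = strong_upper_semilattice +
  assumes interval_distributive:
    "\<lbrakk>a \<in> carrier L; b \<in> carrier L; a \<sqsubseteq> b\<rbrakk>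
      \<Longrightarrow> distributive_lattice (L\<lparr>carrier := \<lbrace>a..b\<rbrace>\<rparr>)"

text \<open>
  The meet of \<open>p\<close> and \<open>q\<close> is partial, so the condition \<open>m = p \<and> q\<close> is expressed by
  \<^const>\<open>greatest\<close> rather than by the total function \<^const>\<open>meet\<close>, whose value is
  unspecified where no greatest lower bound exists.
\<close>

definition meet_irreducible :: "('a, 'b) gorder_scheme \<Rightarrow> 'a \<Rightarrow> bool" where
  "meet_irreducible L m \<longleftrightarrow> m \<in> carrier L \<and>
    (\<forall>p \<in> carrier L. \<forall>q \<in> carrier L. greatest L m (Lower L {p, q}) \<longrightarrow> m = p \<or> m = q)"

definition meet_irreducibles :: "('a, 'b) gorder_scheme \<Rightarrow> ('a, 'b) gorder_scheme" where
  "meet_irreducibles L = L\<lparr>carrier := {m. meet_irreducible L m}\<rparr>"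

definition upwards_closed :: "('a, 'b) gorder_scheme \<Rightarrow> 'a set \<Rightarrow> bool" where
  "upwards_closed P A \<longleftrightarrow> A \<subseteq> carrier P \<and>
    (\<forall>x \<in> A. \<forall>y \<in> carrier P. x \<sqsubseteq>\<^bsub>P\<^esub> y \<longrightarrow> y \<in> A)"

definition filter_lattice :: "('a, 'b) gorder_scheme \<Rightarrow> 'a set gorder" where
  "filter_lattice P =
    \<lparr>carrier = {F. F \<noteq> {} \<and> upwards_closed P F}, eq = (=), le = (\<lambda>F G. G \<subseteq> F)\<rparr>"

definition upper_irreducibles :: "('a, 'b) gorder_scheme \<Rightarrow> 'a \<Rightarrow> 'a set" where
  "upper_irreducibles L x = {m \<in> carrier (meet_irreducibles L). x \<sqsubseteq>\<^bsub>L\<^esub> m}"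

lemma meet_irreducible_top:
  assumes "partial_order L" and "greatest L t (carrier L)"
  shows "meet_irreducible L t"
proof -
  interpret partial_order L by fact
  have t: "t \<in> carrier L" "\<And>x. x \<in> carrier L \<Longrightarrow> x \<sqsubseteq>\<^bsub>L\<^esub> t"
    using assms(2) by (auto simp: greatest_def)
  show ?thesis
    unfolding meet_irreducible_def
  proof (intro conjI ballI impI disjI1)
    fix p q assume pq: "p \<in> carrier L" "q \<in> carrier L" "greatest L t (Lower L {p, q})"
    then have "t \<sqsubseteq>\<^bsub>L\<^esub> p" by (auto simp: greatest_def Lower_def)
    then show "t = p" using pq t le_antisym by blast
  qed (rule t)
qed

lemma partial_order_filter_lattice: "partial_order (filter_lattice P)"
  by unfold_locales (auto simp: filter_lattice_def)

lemma filter_lattice_least_Upper: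
  assumes "greatest P t (carrier P)"
    and F: "F \<in> carrier (filter_lattice P)" and G: "G \<in> carrier (filter_lattice P)"
  shows "least (filter_lattice P) (F \<inter> G) (Upper (filter_lattice P) {F, G})"
proof -
  have "t \<in> H" if "H \<in> carrier (filter_lattice P)" for H
    using assms(1) that by (fastforce simp: filter_lattice_def upwards_closed_def greatest_def)
  then have "F \<inter> G \<noteq> {}" using F G by blast
  then show ?thesis
    using F G by (auto simp: filter_lattice_def upwards_closed_def least_def Upper_def)
qed

lemma filter_lattice_greatest_Lower:
  assumes F: "F \<in> carrier (filter_lattice P)" and G: "G \<in> carrier (filter_lattice P)"
  shows "greatest (filter_lattice P) (F \<union> G) (Lower (filter_lattice P) {F, G})"
  using F G by (auto simp: filter_lattice_def upwards_closed_def greatest_def Lower_def)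

lemma lattice_filter_lattice:
  assumes "greatest P t (carrier P)"
  shows "lattice (filter_lattice P)"
proof -
  interpret partial_order "filter_lattice P" by (rule partial_order_filter_lattice)
  show ?thesis
    by unfold_locales
      (blast intro: filter_lattice_least_Upper[OF assms] filter_lattice_greatest_Lower)+
qed

lemma join_filter_lattice:
  assumes "greatest P t (carrier P)"
    and "F \<in> carrier (filter_lattice P)" and "G \<in> carrier (filter_lattice P)"
  shows "F \<squnion>\<^bsub>filter_lattice P\<^esub> G = F \<inter> G"
proof -
  interpret partial_order "filter_lattice P" by (rule partial_order_filter_lattice)
  show ?thesis
    unfolding join_def sup_def
    using filter_lattice_least_Upper[OF assms] least_unique by (intro some_equality) auto
qed

lemma meet_filter_lattice:
  assumes "F \<in> carrier (filter_lattice P)" and "G \<in> carrier (filter_lattice P)"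
  shows "F \<sqinter>\<^bsub>filter_lattice P\<^esub> G = F \<union> G"
proof -
  interpret partial_order "filter_lattice P" by (rule partial_order_filter_lattice)
  show ?thesis
    unfolding meet_def inf_def
    using filter_lattice_greatest_Lower[OF assms] greatest_unique by (intro some_equality) auto
qed

lemma distributive_lattice_filter_lattice:
  assumes t: "greatest P t (carrier P)"
  shows "distributive_lattice (filter_lattice P)"
proof -
  interpret lattice "filter_lattice P" by (rule lattice_filter_lattice[OF t])
  show ?thesis
  proof unfold_locales
    fix F G H assume c: "F \<in> carrier (filter_lattice P)" "G \<in> carrier (filter_lattice P)"
      "H \<in> carrier (filter_lattice P)"
    then show "F \<sqinter>\<^bsub>filter_lattice P\<^esub> (G \<squnion>\<^bsub>filter_lattice P\<^esub> H)
        = (F \<sqinter>\<^bsub>filter_lattice P\<^esub> G) \<squnion>\<^bsub>filter_lattice P\<^esub> (F \<sqinter>\<^bsub>filter_lattice P\<^esub> H)"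
      using join_closed[of G H] meet_closed[of F G] meet_closed[of F H]
      by (simp add: join_filter_lattice[OF t] meet_filter_lattice Un_Int_distrib)
  qed
qed

end

(*
In a distributive lattice, (m v x) ^ (m v y) = m v (x ^ y). If a meet-irreducible m lies above
x ^ y, the right-hand side is m, so m is one of m v x, m v y, i.e. m lies above x or y. Hence
\<nu> (x ^ y) = \<nu> x \<union> \<nu> y, and by induction the union of the \<nu> s over a finite nonempty set of
elements s with a common lower bound is again some \<nu> z. A filter F above \<nu> x in D is the
union of the \<nu> m for m \<in> F, and these m are all bounded below by x, so F lies in the image.
Injectivity holds because in a finite order every element is obtained from meet-irreducibles
by iterated meets.
*)

theory Submission
  imports Defs
begin

lemma greatest_Lower_pair_iff:
  assumes "x \<in> carrier L" and "y \<in> carrier L"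
  shows "greatest L i (Lower L {x, y}) \<longleftrightarrow>
    i \<in> carrier L \<and> i \<sqsubseteq>\<^bsub>L\<^esub> x \<and> i \<sqsubseteq>\<^bsub>L\<^esub> y \<and>
    (\<forall>z \<in> carrier L. z \<sqsubseteq>\<^bsub>L\<^esub> x \<longrightarrow> z \<sqsubseteq>\<^bsub>L\<^esub> y \<longrightarrow> z \<sqsubseteq>\<^bsub>L\<^esub> i)"
  using assms by (auto simp: greatest_def Lower_def)

lemma mem_upper_irreducibles:
  "m \<in> upper_irreducibles L x \<longleftrightarrow> meet_irreducible L m \<and> x \<sqsubseteq>\<^bsub>L\<^esub> m"
  by (simp add: upper_irreducibles_def meet_irreducibles_def)

lemma meet_irreducible_closed: "meet_irreducible L m \<Longrightarrow> m \<in> carrier L"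
  by (simp add: meet_irreducible_def)

text \<open>Antitone for inclusion, hence isotone for the reverse inclusion that orders
  \<open>filter_lattice\<close>.\<close>

lemma (in partial_order) upper_irreducibles_mono:
  assumes "x \<in> carrier L" and "y \<in> carrier L" and "x \<sqsubseteq> y"
  shows "upper_irreducibles L y \<subseteq> upper_irreducibles L x"
  using assms le_trans by (auto simp: mem_upper_irreducibles meet_irreducible_closed)

text \<open>Order reflection, from which injectivity follows. The induction is on the number of
  elements above \<open>y\<close>: if \<open>y\<close> is reducible, it is the meet of some
  \<open>p\<close> and \<open>q\<close> strictly above it; \<open>x\<close> lies below both by
  induction, hence below their meet \<open>y\<close>.\<close>

lemma (in partial_order) upper_irreducibles_subset_imp_le:
  assumes fin: "finite (carrier L)" and x: "x \<in> carrier L" and "y \<in> carrier L"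
    and "upper_irreducibles L y \<subseteq> upper_irreducibles L x"
  shows "x \<sqsubseteq> y"
  using assms(3,4)
proof (induction y rule: measure_induct_rule[where f = "\<lambda>y. card {z \<in> carrier L. y \<sqsubseteq> z}"])
  case (less y)
  show ?case
  proof (cases "meet_irreducible L y")
    case True
    then have "y \<in> upper_irreducibles L y"
      using less.prems by (simp add: mem_upper_irreducibles)
    then have "y \<in> upper_irreducibles L x" using less.prems by blast
    then show ?thesis by (simp add: mem_upper_irreducibles)
  next
    case False
    then obtain p q where pq: "p \<in> carrier L" "q \<in> carrier L"
      and glb: "greatest L y (Lower L {p, q})" and ne: "y \<noteq> p" "y \<noteq> q"
      using less.prems by (auto simp: meet_irreducible_def)
    have le: "y \<sqsubseteq> p" "y \<sqsubseteq> q" and x_le: "x \<sqsubseteq> p \<Longrightarrow> x \<sqsubseteq> q \<Longrightarrow> x \<sqsubseteq> y"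
      using glb x by (auto simp: greatest_Lower_pair_iff[OF pq])
    have "x \<sqsubseteq> r" if r: "r \<in> carrier L" "y \<sqsubseteq> r" "y \<noteq> r" for r
    proof (rule less.IH)
      have "{z \<in> carrier L. r \<sqsubseteq> z} \<subseteq> {z \<in> carrier L. y \<sqsubseteq> z}"
        using r less.prems(1) le_trans by blast
      \<comment> \<open>The up-set of \<open>r\<close> lacks \<open>y\<close>, so the measure drops
        strictly.\<close>
      moreover have "\<not> r \<sqsubseteq> y" using r less.prems(1) le_antisym by blast
      then have "{z \<in> carrier L. r \<sqsubseteq> z} \<noteq> {z \<in> carrier L. y \<sqsubseteq> z}"
        using less.prems(1) le_refl by blast
      ultimately show "card {z \<in> carrier L. r \<sqsubseteq> z} < card {z \<in> carrier L. y \<sqsubseteq> z}"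
        using fin by (intro psubset_card_mono) auto
      show "upper_irreducibles L r \<subseteq> upper_irreducibles L x"
        using upper_irreducibles_mono[OF less.prems(1) r(1,2)] less.prems(2) by blast
    qed (rule r(1))
    then show ?thesis using pq le ne x_le by blast
  qed
qed

lemma (in upper_semilattice) upper_irreducibles_join:
  assumes "x \<in> carrier L" and "y \<in> carrier L"
  shows "upper_irreducibles L (x \<squnion> y) = upper_irreducibles L x \<inter> upper_irreducibles L y"
proof
  show "upper_irreducibles L (x \<squnion> y) \<subseteq> upper_irreducibles L x \<inter> upper_irreducibles L y"
    using assms upper_irreducibles_mono[OF _ _ join_left] upper_irreducibles_mono[OF _ _ join_right]
    by simp
  show "upper_irreducibles L x \<inter> upper_irreducibles L y \<subseteq> upper_irreducibles L (x \<squnion> y)"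
    using assms join_le by (simp add: subset_iff mem_upper_irreducibles meet_irreducible_closed)
qed

text \<open>The nontrivial half of the dual distributive law. Expanding the meet twice leaves the
  join of \<open>(m \<squnion> x) \<sqinter> m\<close>, \<open>y \<sqinter> m\<close> and
  \<open>y \<sqinter> x\<close>; the first two lie below \<open>m\<close>, the third is the meet on
  the right.\<close>

lemma (in distributive_lattice) meet_of_joins:
  assumes c: "x \<in> carrier L" "y \<in> carrier L" "m \<in> carrier L"
  shows "(m \<squnion> x) \<sqinter> (m \<squnion> y) \<sqsubseteq> m \<squnion> (x \<sqinter> y)"
proof -
  have "(m \<squnion> x) \<sqinter> (m \<squnion> y) = ((m \<squnion> x) \<sqinter> m) \<squnion> ((m \<squnion> x) \<sqinter> y)"
    using c by (simp add: meet_join_distrib)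
  also have "(m \<squnion> x) \<sqinter> y = (y \<sqinter> m) \<squnion> (y \<sqinter> x)"
    using c by (simp add: meet_comm[of L _ y] meet_join_distrib)
  also have "((m \<squnion> x) \<sqinter> m) \<squnion> ((y \<sqinter> m) \<squnion> (y \<sqinter> x)) \<sqsubseteq> m \<squnion> (x \<sqinter> y)"
  proof -
    let ?r = "m \<squnion> (x \<sqinter> y)"
    have m: "m \<sqsubseteq> ?r" and xy: "y \<sqinter> x \<sqsubseteq> ?r"
      using c join_left join_right by (simp_all add: meet_comm[of L y x])
    have "(m \<squnion> x) \<sqinter> m \<sqsubseteq> ?r" "y \<sqinter> m \<sqsubseteq> ?r"
      using c m le_trans[OF meet_right m] by simp_all
    then show ?thesis using c xy by (intro join_le) auto
  qed
  finally show ?thesis .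
qed

context strong_upper_semilattice
begin

text \<open>\<open>\<sqinter>\<close> is a total function defined by choice; the common lower bound
  makes the chosen value a true meet.\<close>

lemma greatest_meet:
  assumes "x \<in> carrier L" and "y \<in> carrier L" and "Lower L {x, y} \<noteq> {}"
  shows "greatest L (x \<sqinter> y) (Lower L {x, y})"
  unfolding meet_def inf_def by (rule someI_ex) (rule inf_of_bounded_pair_exists[OF assms])

lemma greatest_carrier_top: "greatest L \<top> (carrier L)"
  using top_exists by (auto simp: greatest_def)

text \<open>A top among the irreducibles keeps intersections of filters nonempty, as
  \<open>join_filter_lattice\<close> requires.\<close>

lemma greatest_top_meet_irreducibles:
  "greatest (meet_irreducibles L) \<top> (carrier (meet_irreducibles L))"
  using meet_irreducible_top[OF partial_order_axioms greatest_carrier_top]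
  by (auto simp: greatest_def meet_irreducibles_def meet_irreducible_closed)

lemma upper_irreducibles_closed:
  assumes x: "x \<in> carrier L"
  shows "upper_irreducibles L x \<in> carrier (filter_lattice (meet_irreducibles L))"
proof -
  have "\<top> \<in> upper_irreducibles L x"
    using x meet_irreducible_top[OF partial_order_axioms greatest_carrier_top]
    by (simp add: mem_upper_irreducibles)
  moreover have "upwards_closed (meet_irreducibles L) (upper_irreducibles L x)"
    using x
    by (auto simp: upwards_closed_def mem_upper_irreducibles meet_irreducibles_def
        meet_irreducible_closed intro: le_trans[of x])
  ultimately show ?thesis by (auto simp: filter_lattice_def)
qed

end

context distributive_strong_upper_semilattice
begin

text \<open>Irreducible elements are prime: distributivity makes \<open>m\<close> the meet in all of
  \<open>L\<close> of \<open>m \<squnion> x\<close> and \<open>m \<squnion> y\<close>, so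
  \<open>m\<close> equals one of these joins.\<close>

lemma meet_irreducible_above_meet:
  assumes m: "meet_irreducible L m" and x: "x \<in> carrier L" and y: "y \<in> carrier L"
    and glb: "greatest L a (Lower L {x, y})" and am: "a \<sqsubseteq> m"
  shows "x \<sqsubseteq> m \<or> y \<sqsubseteq> m"
proof -
  note mc = meet_irreducible_closed[OF m]
  have a: "a \<in> carrier L" "a \<sqsubseteq> x" "a \<sqsubseteq> y"
    and a_greatest: "\<And>z. z \<in> carrier L \<Longrightarrow> z \<sqsubseteq> x \<Longrightarrow> z \<sqsubseteq> y \<Longrightarrow> z \<sqsubseteq> a"
    using glb by (auto simp: greatest_Lower_pair_iff[OF x y])
  \<comment> \<open>Since \<open>a\<close> lies below \<open>x\<close>, \<open>y\<close> and
    \<open>m\<close>, this interval contains all three, and distributivity can be applied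
    there.\<close>
  define J where "J = L\<lparr>carrier := \<lbrace>a..\<top>\<rbrace>\<rparr>"
  have J_carrier: "z \<in> carrier J \<longleftrightarrow> z \<in> carrier L \<and> a \<sqsubseteq> z" for z
    by (auto simp: J_def at_least_at_most_def)
  have J_le: "le J = le L" by (simp add: J_def)
  interpret J: distributive_lattice J
    unfolding J_def using a by (intro interval_distributive) auto
  have J: "x \<in> carrier J" "y \<in> carrier J" "m \<in> carrier J"
    using a am x y mc by (auto simp: J_carrier)
  let ?p = "m \<squnion> x" and ?q = "m \<squnion> y"
  have pq: "?p \<in> carrier L" "?q \<in> carrier L" using mc x y by auto
  have m_le: "m \<sqsubseteq> ?p" "m \<sqsubseteq> ?q" using mc x y join_left by auto
  \<comment> \<open>Joins of \<open>J\<close> are taken inside the interval. They are still upper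
    bounds in \<open>L\<close>, hence above the joins of \<open>L\<close>, and this inequality
    suffices.\<close>
  have p_le: "?p \<sqsubseteq> m \<squnion>\<^bsub>J\<^esub> x" and q_le: "?q \<sqsubseteq> m \<squnion>\<^bsub>J\<^esub> y"
    using J.join_left[of m x] J.join_right[of m x] J.join_left[of m y] J.join_right[of m y]
      J J.join_closed[of m x] J.join_closed[of m y] mc x y
    by (auto simp: J_le J_carrier intro: join_le)
  have "z \<sqsubseteq> m" if z: "z \<in> carrier L" "z \<sqsubseteq> ?p" "z \<sqsubseteq> ?q" for z
  proof -
    txt \<open>\<open>z\<close> itself need not lie in the interval.\<close>
    define w where "w = z \<squnion> m"
    have w: "w \<in> carrier L" "z \<sqsubseteq> w" "m \<sqsubseteq> w" "w \<sqsubseteq> ?p" "w \<sqsubseteq> ?q"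
      unfolding w_def using z mc pq m_le by (auto intro: join_left join_right join_le)
    have wJ: "w \<in> carrier J" using w(1) le_trans[OF am w(3) a(1) mc] by (simp add: J_carrier)
    have jc: "m \<squnion>\<^bsub>J\<^esub> x \<in> carrier L" "m \<squnion>\<^bsub>J\<^esub> y \<in> carrier L"
      using J J.join_closed[of m x] J.join_closed[of m y] by (simp_all add: J_carrier)
    have "w \<sqsubseteq>\<^bsub>J\<^esub> (m \<squnion>\<^bsub>J\<^esub> x) \<sqinter>\<^bsub>J\<^esub> (m \<squnion>\<^bsub>J\<^esub> y)"
      using wJ J le_trans[OF w(4) p_le] le_trans[OF w(5) q_le] w(1) pq jc
      by (intro J.meet_le) (simp_all add: J_le)
    also have "\<dots> \<sqsubseteq>\<^bsub>J\<^esub> m \<squnion>\<^bsub>J\<^esub> (x \<sqinter>\<^bsub>J\<^esub> y)" using J by (intro J.meet_of_joins)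
    \<comment> \<open>The meet in \<open>J\<close> is a common lower bound of \<open>x\<close> and
      \<open>y\<close> in \<open>L\<close>, so it lies below \<open>a\<close> and hence below
      \<open>m\<close>.\<close>
    also have "\<dots> \<sqsubseteq>\<^bsub>J\<^esub> m"
    proof (rule J.join_le)
      have c: "x \<sqinter>\<^bsub>J\<^esub> y \<in> carrier L" 
        using J J.meet_closed[of x y] by (simp add: J_carrier)
      have "x \<sqinter>\<^bsub>J\<^esub> y \<sqsubseteq> a"
        using a_greatest[OF c] J.meet_left[of x y] J.meet_right[of x y] J by (simp add: J_le)
      then show "x \<sqinter>\<^bsub>J\<^esub> y \<sqsubseteq>\<^bsub>J\<^esub> m" 
        using le_trans[OF _ am c a(1) mc] by (simp add: J_le)
    qed (use J in auto)
    finally have "w \<sqsubseteq> m" using wJ J by (simp add: J_le)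
    with w(2) show ?thesis using z(1) w(1) mc by (rule le_trans)
  qed
  then have "greatest L m (Lower L {?p, ?q})"
    using mc m_le by (auto simp: greatest_Lower_pair_iff[OF pq])
  then have "m = ?p \<or> m = ?q" using m pq by (auto simp: meet_irreducible_def)
  then show ?thesis using join_right[OF mc x] join_right[OF mc y] by auto
qed

lemma upper_irreducibles_meet:
  assumes x: "x \<in> carrier L" and y: "y \<in> carrier L" and ne: "Lower L {x, y} \<noteq> {}"
  shows "upper_irreducibles L (x \<sqinter> y) = upper_irreducibles L x \<union> upper_irreducibles L y"
proof -
  note glb = greatest_meet[OF assms]
  then have "x \<sqinter> y \<in> carrier L" "x \<sqinter> y \<sqsubseteq> x" "x \<sqinter> y \<sqsubseteq> y"
    by (auto simp: greatest_Lower_pair_iff[OF x y])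
  then have "upper_irreducibles L x \<union> upper_irreducibles L y \<subseteq> upper_irreducibles L (x \<sqinter> y)"
    using x y upper_irreducibles_mono by blast
  moreover have "upper_irreducibles L (x \<sqinter> y) \<subseteq> upper_irreducibles L x \<union> upper_irreducibles L y"
    by (auto simp: mem_upper_irreducibles dest: meet_irreducible_above_meet[OF _ x y glb])
  ultimately show ?thesis by blast
qed

text \<open>The bound \<open>x \<sqsubseteq> z\<close> is carried through the induction because it
  guarantees that the next meet \<open>s \<sqinter> z\<close> exists.\<close>

lemma Union_upper_irreducibles:
  assumes "finite S" and "S \<noteq> {}" and "S \<subseteq> carrier L" and x: "x \<in> carrier L"
    and "\<And>s. s \<in> S \<Longrightarrow> x \<sqsubseteq> s"
  shows "\<exists>z \<in> carrier L. x \<sqsubseteq> z \<and> upper_irreducibles L z = (\<Union>s \<in> S. upper_irreducibles L s)"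
  using assms(1-3,5)
proof (induction S rule: finite_ne_induct)
  case (singleton s)
  then show ?case by auto
next
  case (insert s S)
  then obtain z where z: "z \<in> carrier L" "x \<sqsubseteq> z"
    "upper_irreducibles L z = (\<Union>s \<in> S. upper_irreducibles L s)"
    by auto
  have s: "s \<in> carrier L" "x \<sqsubseteq> s" using insert.prems by auto
  have ne: "Lower L {s, z} \<noteq> {}" using s z x by (auto simp: Lower_def)
  have "s \<sqinter> z \<in> carrier L" "x \<sqsubseteq> s \<sqinter> z"
    using greatest_meet[OF s(1) z(1) ne] s z x by (auto simp: greatest_Lower_pair_iff)
  then show ?case
    using upper_irreducibles_meet[OF s(1) z(1) ne] z(3) by (intro bexI[of _ "s \<sqinter> z"]) auto
qed

lemma upwards_closed_range_upper_irreducibles: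
  assumes fin: "finite (carrier L)"
  shows "upwards_closed (filter_lattice (meet_irreducibles L)) (upper_irreducibles L ` carrier L)"
proof -
  have "F \<in> upper_irreducibles L ` carrier L"
    if x: "x \<in> carrier L" and F: "F \<in> carrier (filter_lattice (meet_irreducibles L))"
      \<comment> \<open>In the reverse inclusion order this says that \<open>F\<close> lies above
        the image of \<open>x\<close>; it also makes \<open>x\<close> a common lower bound of the
        elements of \<open>F\<close>.\<close>
      and sub: "F \<subseteq> upper_irreducibles L x" for x F
  proof -
    have FL: "F \<subseteq> carrier L" and F_ge: "\<And>m. m \<in> F \<Longrightarrow> x \<sqsubseteq> m"
      using sub by (auto simp: mem_upper_irreducibles meet_irreducible_closed)
    have "F \<noteq> {}" using F by (simp add: filter_lattice_def)
    then obtain z where z: "z \<in> carrier L"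
      "upper_irreducibles L z = (\<Union>m \<in> F. upper_irreducibles L m)"
      using Union_upper_irreducibles[OF finite_subset[OF FL fin] _ FL x F_ge] by blast
    \<comment> \<open>A filter is the union of the principal filters of its members: upward closure
      gives one inclusion, reflexivity the other.\<close>
    have "(\<Union>m \<in> F. upper_irreducibles L m) = F"
    proof
      show "(\<Union>m \<in> F. upper_irreducibles L m) \<subseteq> F"
        using F by (auto simp: filter_lattice_def upwards_closed_def meet_irreducibles_def
            mem_upper_irreducibles)
      show "F \<subseteq> (\<Union>m \<in> F. upper_irreducibles L m)"
        using sub FL by (force simp: mem_upper_irreducibles)
    qed
    then show ?thesis using z by blast
  qed
  then show ?thesis
    using upper_irreducibles_closed
    by (auto simp: upwards_closed_def[of "filter_lattice _"]) (auto simp: filter_lattice_def)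
qed

end

theorem mainTheorem1:
  fixes L :: "('a, 'b) gorder_scheme"
  assumes "distributive_strong_upper_semilattice L"
    and "finite (carrier L)"
  shows "let D = filter_lattice (meet_irreducibles L); \<nu> = upper_irreducibles L in
    \<nu> \<in> carrier L \<rightarrow> carrier D \<and>
    isotone L D \<nu> \<and>
    inj_on \<nu> (carrier L) \<and>
    (\<forall>x \<in> carrier L. \<forall>y \<in> carrier L. \<nu> (x \<squnion>\<^bsub>L\<^esub> y) = \<nu> x \<squnion>\<^bsub>D\<^esub> \<nu> y) \<and>
    (\<forall>x \<in> carrier L. \<forall>y \<in> carrier L. Lower L {x, y} \<noteq> {} \<longrightarrow>
      \<nu> (x \<sqinter>\<^bsub>L\<^esub> y) = \<nu> x \<sqinter>\<^bsub>D\<^esub> \<nu> y) \<and>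
    upwards_closed D (\<nu> ` carrier L)"
proof -
  interpret distributive_strong_upper_semilattice L by fact
  let ?D = "filter_lattice (meet_irreducibles L)" and ?\<nu> = "upper_irreducibles L"
  interpret D: partial_order ?D by (rule partial_order_filter_lattice)
  note closed = upper_irreducibles_closed
  have "isotone L ?D ?\<nu>"
    using upper_irreducibles_mono weak_partial_order_axioms D.weak_partial_order_axioms
    by (auto simp: isotone_def filter_lattice_def)
  \<comment> \<open>Equal images are included in each other both ways, so order reflection applies
    twice and antisymmetry finishes.\<close>
  moreover have "inj_on ?\<nu> (carrier L)"
    using upper_irreducibles_subset_imp_le[OF assms(2)] le_antisym by (intro inj_onI) simp
  moreover have "?\<nu> (x \<squnion>\<^bsub>L\<^esub> y) = ?\<nu> x \<squnion>\<^bsub>?D\<^esub> ?\<nu> y" if "x \<in> carrier L" "y \<in> carrier L" for x y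
    using that closed
    by (simp add: upper_irreducibles_join join_filter_lattice[OF greatest_top_meet_irreducibles])
  moreover have "?\<nu> (x \<sqinter>\<^bsub>L\<^esub> y) = ?\<nu> x \<sqinter>\<^bsub>?D\<^esub> ?\<nu> y"
    if "x \<in> carrier L" "y \<in> carrier L" "Lower L {x, y} \<noteq> {}" for x y
    using that closed by (simp add: upper_irreducibles_meet meet_filter_lattice)
  ultimately show ?thesis
    using closed upwards_closed_range_upper_irreducibles[OF assms(2)] by (simp add: Let_def)
qed

end
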